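(* Let $D$ be a set, $k$ a positive integer, $X\subseteq D^k$ a finite symmetric subset, $d$ a positive integer, and $f:X\to\mathbb{C}$ a symmetric function, i.e. $f(x_{\tau(1)},\dots,x_{\tau(k)})=f(x_1,\dots,x_k)$ for all $(x_1,\dots,x_k)\in X$ and $\tau\in S_k$. Then $$\sum_{[x_1,\dots,x_k]\in\overline{\mathcal{M}}_d(X)} f(x_1,\dots,x_k)=\frac{1}{k!}\sum_{\tau\in S_k}\overline{w}_d(\tau)\sum_{(x_1,\dots,x_k)\in X_\tau} f(x_1,\dots,x_k).$$
   Context: A subset $X\subseteq D^k$ is symmetric if $(x_{\tau(1)},\dots,x_{\tau(k)})\in X$ whenever $(x_1,\dots,x_k)\in X$ and $\tau\in S_k$. $\mathcal{M}(X)=\{[x_1,\dots,x_k]:(x_1,\dots,x_k)\in X\}$ is the set of $k$-multisets with underlying ordered tuples in $X$; $\overline{\mathcal{M}}_d(X)$ is the subset of those with exactly $d$ distinct elements. For $\tau\in S_k$, $X_\tau$ is the set of $(x_1,\dots,x_k)\in X$ with $x_i$ constant on each cycle of $\tau$. If $\tau$ has cycle lengths $\ell_1,\dots,\ell_{c(\tau)}$ (fixed points counted as cycles of length 1), $\overline{w}_d(\tau)=[x^d]\prod_{i=1}^{c(\tau)}\bigl(1-(1-x)^{\ell_i}\bigr)$, the coefficient of $x^d$ in that polynomial. *)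

theory Defs
  imports
    Complex_Main
    "HOL-Library.Multiset"
    "HOL-Computational_Algebra.Polynomial"
    "HOL-Combinatorics.Permutations"
    "HOL-Combinatorics.Orbits"
begin

text \<open>A tuple \<open>(x\<^sub>1, \<dots>, x\<^sub>k)\<close> is a list of length \<open>k\<close>, with positions \<open>{..<k}\<close>; accordingly
  \<open>S\<^sub>k\<close> is the set of permutations of \<open>{..<k}\<close>, acting by \<^const>\<open>permute_list\<close>.\<close>

definition tuples :: "'a set \<Rightarrow> nat \<Rightarrow> 'a list set" where
  "tuples D k = {xs. length xs = k \<and> set xs \<subseteq> D}"

definition Sym :: "nat \<Rightarrow> (nat \<Rightarrow> nat) set" where
  "Sym k = {\<tau>. \<tau> permutes {..<k}}"

definition symmetric_set :: "nat \<Rightarrow> 'a list set \<Rightarrow> bool" where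
  "symmetric_set k X \<longleftrightarrow> (\<forall>xs\<in>X. \<forall>\<tau>\<in>Sym k. permute_list \<tau> xs \<in> X)"

definition symmetric_fun :: "nat \<Rightarrow> 'a list set \<Rightarrow> ('a list \<Rightarrow> 'b) \<Rightarrow> bool" where
  "symmetric_fun k X f \<longleftrightarrow> (\<forall>xs\<in>X. \<forall>\<tau>\<in>Sym k. f (permute_list \<tau> xs) = f xs)"

definition msets :: "'a list set \<Rightarrow> 'a multiset set" where
  "msets X = mset ` X"

definition msets_distinct :: "nat \<Rightarrow> 'a list set \<Rightarrow> 'a multiset set" where
  "msets_distinct d X = {M \<in> msets X. card (set_mset M) = d}"

text \<open>The value of a symmetric function at a multiset, read off from any of its orderings in \<open>X\<close>;
  the choice is immaterial by the lemma \<open>mset_value_mset\<close> below.\<close>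

definition mset_value :: "'a list set \<Rightarrow> ('a list \<Rightarrow> 'b) \<Rightarrow> 'a multiset \<Rightarrow> 'b" where
  "mset_value X f M = f (SOME xs. xs \<in> X \<and> mset xs = M)"

text \<open>The cycles of \<open>\<tau> \<in> S\<^sub>k\<close> as sets of positions; a fixed point \<open>i\<close> contributes the cycle \<open>{i}\<close>.\<close>

definition perm_cycles :: "nat \<Rightarrow> (nat \<Rightarrow> nat) \<Rightarrow> nat set set" where
  "perm_cycles k \<tau> = orbit \<tau> ` {..<k}"

definition constant_on_cycles :: "nat \<Rightarrow> 'a list set \<Rightarrow> (nat \<Rightarrow> nat) \<Rightarrow> 'a list set" where
  "constant_on_cycles k X \<tau> =
     {xs \<in> X. \<forall>C \<in> perm_cycles k \<tau>. \<forall>i\<in>C. \<forall>j\<in>C. xs ! i = xs ! j}"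

definition cycle_weight :: "nat \<Rightarrow> nat \<Rightarrow> (nat \<Rightarrow> nat) \<Rightarrow> int" where
  "cycle_weight k d \<tau> = coeff (\<Prod>C \<in> perm_cycles k \<tau>. 1 - (1 - [:0, 1:]) ^ card C) d"

lemma mset_value_mset:
  assumes "X \<subseteq> tuples D k" "symmetric_fun k X f" "xs \<in> X"
  shows "mset_value X f (mset xs) = f xs"
proof -
  define ys where "ys = (SOME ys. ys \<in> X \<and> mset ys = mset xs)"
  have ys: "ys \<in> X \<and> mset ys = mset xs"
    unfolding ys_def by (rule someI[of _ xs]) (use assms in simp)
  obtain \<tau> where "\<tau> permutes {..<length xs}" "permute_list \<tau> xs = ys"
    using mset_eq_permutation[of ys xs] ys by auto
  moreover have "length xs = k"
    using assms by (auto simp: tuples_def)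
  ultimately have "f ys = f xs"
    using assms by (auto simp: symmetric_fun_def Sym_def)
  then show ?thesis
    by (simp add: mset_value_def ys_def)
qed

end

theory Submission
  imports Defs "HOL-Combinatorics.Multiset_Permutations"
begin

text \<open>Exchanging the sums over \<open>\<tau>\<close> and over tuples, one has to show that for a tuple \<open>x\<close> taking
  \<open>r\<close> distinct values with multiplicities \<open>m\<^sub>v\<close>, the polynomials \<open>\<Prod>\<^sub>C (1 - (1 - t)\<^bsup>|C|\<^esup>)\<close>, summed over
  all \<open>\<tau>\<close> that preserve \<open>x\<close>, add up to \<open>(\<Prod>\<^sub>v m\<^sub>v!) t\<^sup>r\<close>: the coefficient \<open>\<Prod>\<^sub>v m\<^sub>v!\<close> then compensates
  for the \<open>k! / \<Prod>\<^sub>v m\<^sub>v!\<close> orderings of a multiset.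

  The product for \<open>\<tau>\<close> is the probability that a random subset \<open>T\<close> of the positions, each
  chosen independently with probability \<open>t\<close>, meets every cycle of \<open>\<tau>\<close>. For fixed \<open>T\<close>, inserting
  the positions outside \<open>T\<close> one at a time into existing cycles shows that exactly
  \<open>\<Prod>\<^sub>v |T\<^sub>v| (m\<^sub>v - 1)!\<close> permutations preserving \<open>x\<close> have all their cycles met by \<open>T\<close>, where \<open>T\<^sub>v\<close> is
  the set of positions in \<open>T\<close> with value \<open>v\<close>. Finally \<open>\<Prod>\<^sub>v |T\<^sub>v|\<close> has expectation \<open>t\<^sup>r \<Prod>\<^sub>v m\<^sub>v\<close>.\<close>

section \<open>Weighted sums over subsets\<close>

lemma sum_Pow_power_card:
  fixes s t :: "'b::comm_semiring_1"
  assumes "finite A"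
  shows "(\<Sum>T\<in>Pow A. s ^ card T * t ^ card (A - T)) = (s + t) ^ card A"
  using prod_add[OF assms, of "\<lambda>_. s" "\<lambda>_. t"] by simp

text \<open>If the points of \<open>A\<close> are selected independently with probability
  \<open>t\<close>, this is the probability that all of \<open>S\<close> is selected:
  \<open>t ^ card S\<close> factors out, and the weights on \<open>A - S\<close> sum to 1.\<close>

lemma sum_supersets_power_card:
  fixes t :: "'b::comm_ring_1"
  assumes "finite A" "S \<subseteq> A"
  shows "(\<Sum>T | T \<subseteq> A \<and> S \<subseteq> T. t ^ card T * (1 - t) ^ card (A - T)) = t ^ card S"
proof -
  have fin: "finite S" "finite (A - S)"
    using assms by (auto intro: finite_subset)
  have "(\<Sum>T | T \<subseteq> A \<and> S \<subseteq> T. t ^ card T * (1 - t) ^ card (A - T)) =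
        (\<Sum>U\<in>Pow (A - S). t ^ card S * (t ^ card U * (1 - t) ^ card (A - S - U)))"
  proof (rule sum.reindex_bij_witness[of _ "\<lambda>U. S \<union> U" "\<lambda>T. T - S"])
    fix T assume "T \<in> {T. T \<subseteq> A \<and> S \<subseteq> T}"
    then have T: "T \<subseteq> A" "S \<subseteq> T" by auto
    then have "card T = card S + card (T - S)"
      using fin assms by (metis card_Diff_subset card_mono finite_subset le_add_diff_inverse)
    moreover have "A - S - (T - S) = A - T" using T by auto
    ultimately show "t ^ card S * (t ^ card (T - S) * (1 - t) ^ card (A - S - (T - S))) =
        t ^ card T * (1 - t) ^ card (A - T)"
      by (simp add: power_add mult.assoc)
  qed (use assms in auto)
  also have "\<dots> = t ^ card S"
    using sum_Pow_power_card[OF fin(2), of t "1 - t"] by (simp flip: sum_distrib_left)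
  finally show ?thesis .
qed

text \<open>If each point is selected independently with probability \<open>t\<close>, both sides are the probability
  that every block contains a selected point.\<close>

lemma prod_blocks_eq_sum_hitting_sets:
  fixes t :: "'b::comm_ring_1"
  assumes "finite F" "pairwise disjnt F" "\<And>C. C \<in> F \<Longrightarrow> finite C"
  shows "(\<Prod>C\<in>F. 1 - (1 - t) ^ card C) =
    (\<Sum>T | T \<subseteq> \<Union>F \<and> (\<forall>C\<in>F. C \<inter> T \<noteq> {}). t ^ card T * (1 - t) ^ card (\<Union>F - T))"
  using assms
proof (induction F rule: finite_induct)
  case empty
  have "{T. T \<subseteq> \<Union>{} \<and> (\<forall>C\<in>{}. C \<inter> T \<noteq> {})} = {{}::'a set}" by auto
  then show ?case by simp
next
  case (insert C F)
  let ?w = "\<lambda>A T. t ^ card T * (1 - t) ^ card (A - T)"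
  let ?H = "{T. T \<subseteq> \<Union>F \<and> (\<forall>C\<in>F. C \<inter> T \<noteq> {})}"
  have fin: "finite C" "finite (\<Union>F)"
    using insert.prems insert.hyps by auto
  have disj: "C \<inter> \<Union>F = {}"
    using insert.prems(1) insert.hyps(2) by (fastforce simp: pairwise_insert disjnt_def)
  have IH: "(\<Prod>C\<in>F. 1 - (1 - t) ^ card C) = sum (?w (\<Union>F)) ?H"
    using insert by (simp add: pairwise_insert)
  have "(\<Sum>U\<in>Pow C - {{}}. ?w C U) = 1 - (1 - t) ^ card C"
    using sum_Pow_power_card[OF fin(1), of t "1 - t"] fin by (subst sum_diff1) auto
  then have "(\<Prod>C\<in>insert C F. 1 - (1 - t) ^ card C) = (\<Sum>U\<in>Pow C - {{}}. ?w C U) * sum (?w (\<Union>F)) ?H"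
    using insert.hyps IH by simp
  also have "\<dots> = (\<Sum>(U, T)\<in>(Pow C - {{}}) \<times> ?H. ?w C U * ?w (\<Union>F) T)"
    by (simp add: sum_product sum.cartesian_product)
  \<comment> \<open>A set meeting every block splits uniquely into a nonempty part in
    \<open>C\<close> and a subset of \<open>\<Union>F\<close> meeting every block of
    \<open>F\<close>.\<close>
  also have "\<dots> = (\<Sum>T | T \<subseteq> \<Union>(insert C F) \<and> (\<forall>D\<in>insert C F. D \<inter> T \<noteq> {}). ?w (\<Union>(insert C F)) T)"
  proof (rule sum.reindex_bij_witness[of _ "\<lambda>T. (T \<inter> C, T \<inter> \<Union>F)" "\<lambda>(U, T). U \<union> T"], goal_cases)
    case (1 a) then show ?case using disj by auto
  next
    case (2 a) then show ?case using disj by fastforce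
  next
    case (3 T) then show ?case by auto
  next
    case (4 T) then show ?case by fastforce
  next
    case (5 a)
    obtain U T where a: "a = (U, T)" by fastforce
    have UT: "U \<subseteq> C" "T \<subseteq> \<Union>F" using 5 a by auto
    have "card (U \<union> T) = card U + card T"
      using UT fin disj by (intro card_Un_disjoint) (auto intro: finite_subset)
    moreover have "\<Union>(insert C F) - (U \<union> T) = (C - U) \<union> (\<Union>F - T)"
      using UT disj by auto
    moreover have "card ((C - U) \<union> (\<Union>F - T)) = card (C - U) + card (\<Union>F - T)"
      using fin disj by (intro card_Un_disjoint) auto
    ultimately show ?case by (simp add: a power_add mult_ac)
  qed
  finally show ?case .
qed

section \<open>Fibre-preserving permutations\<close>

definition fibre :: "('a \<Rightarrow> 'b) \<Rightarrow> 'a set \<Rightarrow> 'b \<Rightarrow> 'a set" where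
  "fibre x A v = {i \<in> A. x i = v}"

definition fibre_perms :: "('a \<Rightarrow> 'b) \<Rightarrow> 'a set \<Rightarrow> ('a \<Rightarrow> 'a) set" where
  "fibre_perms x A = {\<tau>. \<tau> permutes A \<and> (\<forall>i\<in>A. x (\<tau> i) = x i)}"

text \<open>For a permutation of a finite \<open>A\<close> this says that every cycle meets \<open>T\<close>; the formulation
  through invariant sets behaves well when a point is inserted into a cycle.\<close>

definition hits_cycles :: "'a set \<Rightarrow> 'a set \<Rightarrow> ('a \<Rightarrow> 'a) \<Rightarrow> bool" where
  "hits_cycles A T \<tau> \<longleftrightarrow> (\<forall>U. U \<subseteq> A - T \<and> \<tau> ` U \<subseteq> U \<longrightarrow> U = {})"

lemma finite_fibre [simp]: "finite A \<Longrightarrow> finite (fibre x A v)"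
  by (simp add: fibre_def)

lemma fibre_insert: "fibre x (insert b A) v = (if x b = v then insert b (fibre x A v) else fibre x A v)"
  by (auto simp: fibre_def)

lemma fibre_eq_empty_iff: "fibre x A v = {} \<longleftrightarrow> v \<notin> x ` A"
  by (auto simp: fibre_def)

lemma finite_fibre_perms [simp]: "finite A \<Longrightarrow> finite (fibre_perms x A)"
  by (rule finite_subset[OF _ finite_permutations[of A]]) (auto simp: fibre_perms_def)

lemma orbit_subset_invariant:
  assumes "\<tau> ` U \<subseteq> U" "i \<in> U" shows "orbit \<tau> i \<subseteq> U"
proof
  fix j assume "j \<in> orbit \<tau> i"
  then show "j \<in> U" by induction (use assms in auto)
qed

text \<open>The orbits are the minimal nonempty invariant sets, so some nonempty invariant set
  avoids \<open>T\<close> exactly if some orbit does.\<close>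

lemma hits_cycles_iff_orbits:
  assumes "\<tau> permutes A"
  shows "hits_cycles A T \<tau> \<longleftrightarrow> (\<forall>C\<in>orbit \<tau> ` A. C \<inter> T \<noteq> {})"
proof
  assume h: "hits_cycles A T \<tau>"
  have "orbit \<tau> i \<inter> T \<noteq> {}" if "i \<in> A" for i
  proof
    assume "orbit \<tau> i \<inter> T = {}"
    moreover have "orbit \<tau> i \<subseteq> A"
      using that permutes_image[OF assms] by (intro orbit_subset_invariant) auto
    ultimately have "orbit \<tau> i = {}"
      using h unfolding hits_cycles_def by (metis Diff_eq Int_subset_iff disjoint_eq_subset_Compl
        image_subsetI orbit.step)
    then show False by (simp add: orbit_nonempty)
  qed
  then show "\<forall>C\<in>orbit \<tau> ` A. C \<inter> T \<noteq> {}" by auto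
next
  assume h: "\<forall>C\<in>orbit \<tau> ` A. C \<inter> T \<noteq> {}"
  show "hits_cycles A T \<tau>"
    unfolding hits_cycles_def
  proof (intro allI impI, rule ccontr)
    fix U assume U: "U \<subseteq> A - T \<and> \<tau> ` U \<subseteq> U" "U \<noteq> {}"
    then obtain i where "i \<in> U" by auto
    then have "orbit \<tau> i \<subseteq> U" using U by (intro orbit_subset_invariant) auto
    then show False using h U \<open>i \<in> U\<close> by blast
  qed
qed

text \<open>In \<^term>\<open>transpose b c \<circ> \<sigma>\<close> the point \<open>b\<close> is inserted immediately before \<open>c\<close> into a cycle
  of \<open>\<sigma>\<close>, or becomes a fixed point if \<open>c = b\<close>.\<close>

lemma fibre_perms_insert:
  assumes "b \<notin> A"
  shows "bij_betw (\<lambda>(c, \<sigma>). transpose b c \<circ> \<sigma>)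
    (fibre x (insert b A) (x b) \<times> fibre_perms x A) (fibre_perms x (insert b A))"
    (is "bij_betw ?g ?S ?P")
proof (rule bij_betw_imageI)
  show "inj_on ?g ?S"
  proof (rule inj_onI, clarify)
    fix c \<sigma> c' \<sigma>'
    assume \<sigma>: "\<sigma> \<in> fibre_perms x A" "\<sigma>' \<in> fibre_perms x A"
      and eq: "transpose b c \<circ> \<sigma> = transpose b c' \<circ> \<sigma>'"
    have "\<sigma> b = b" "\<sigma>' b = b"
      using \<sigma> assms by (auto simp: fibre_perms_def permutes_def)
    then have "c = c'" using fun_cong[OF eq, of b] by simp
    moreover from this have "\<sigma> = \<sigma>'"
      using eq by (metis comp_assoc id_comp transpose_comp_involutory)
    ultimately show "c = c' \<and> \<sigma> = \<sigma>'" by simp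
  qed
  show "?g ` ?S = ?P"
  proof (intro equalityI subsetI)
    fix p assume "p \<in> ?g ` ?S"
    then obtain c \<sigma> where c: "c \<in> insert b A" "x c = x b" and \<sigma>: "\<sigma> permutes A" "\<forall>i\<in>A. x (\<sigma> i) = x i"
      and p: "p = transpose b c \<circ> \<sigma>"
      by (auto simp: fibre_def fibre_perms_def)
    have "p permutes insert b A"
      using permutes_insert[of b A] c \<sigma> p by auto
    moreover have "x (p i) = x i" if "i \<in> insert b A" for i
    proof -
      have "x (transpose b c j) = x j" for j
        using c by (auto simp: transpose_def)
      moreover have "x (\<sigma> i) = x i"
        using \<sigma> that assms by (auto simp: permutes_def)
      ultimately show ?thesis by (simp add: p)
    qed
    ultimately show "p \<in> ?P" by (simp add: fibre_perms_def)
  next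
    fix p assume "p \<in> ?P"
    then have p: "p permutes insert b A" "\<And>i. i \<in> insert b A \<Longrightarrow> x (p i) = x i"
      by (auto simp: fibre_perms_def)
    \<comment> \<open>Composing with this transposition removes \<open>b\<close> from its cycle in
      \<open>p\<close>, which recovers the pair that \<open>p\<close> came from.\<close>
    let ?\<sigma> = "transpose b (p b) \<circ> p"
    have "x (transpose b (p b) j) = x j" for j
      using p(2) by (auto simp: transpose_def)
    then have "?\<sigma> \<in> fibre_perms x A"
      using permutes_insert_lemma[OF p(1)] p(2) by (auto simp: fibre_perms_def)
    moreover have "p b \<in> fibre x (insert b A) (x b)"
      using p permutes_in_image[OF p(1)] by (auto simp: fibre_def)
    moreover have "p = transpose b (p b) \<circ> ?\<sigma>"
      by (simp add: fun_eq_iff)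
    ultimately show "p \<in> ?g ` ?S"
      by (intro image_eqI[of _ _ "(p b, ?\<sigma>)"]) auto
  qed
qed

text \<open>For \<open>c = b\<close> the new fixed point lies outside \<open>T\<close>. Otherwise
  \<open>b\<close> joins the cycle of \<open>c\<close>, and as \<open>b\<close> is not in
  \<open>T\<close>, no cycle changes its intersection with \<open>T\<close>.\<close>

lemma hits_cycles_insert:
  assumes "b \<notin> A" "b \<notin> T" "\<sigma> permutes A" "c \<in> insert b A"
  shows "hits_cycles (insert b A) T (transpose b c \<circ> \<sigma>) \<longleftrightarrow> c \<noteq> b \<and> hits_cycles A T \<sigma>"
    (is "?L \<longleftrightarrow> ?R")
proof
  have \<sigma>b: "\<sigma> b = b" using assms by (auto simp: permutes_def)
  have \<sigma>A: "\<sigma> i \<in> A" if "i \<in> A" for i using assms that by (simp add: permutes_in_image)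
  {
    assume L: ?L
    have "c \<noteq> b"
    proof
      assume "c = b"
      then have "{b} \<subseteq> insert b A - T \<and> (transpose b c \<circ> \<sigma>) ` {b} \<subseteq> {b}"
        using \<sigma>b assms by auto
      then show False using L unfolding hits_cycles_def by blast
    qed
    moreover have "U = {}" if U: "U \<subseteq> A - T" "\<sigma> ` U \<subseteq> U" for U
    proof -
      \<comment> \<open>A point that \<open>\<sigma>\<close> sends to \<open>c\<close> is now sent
        to \<open>b\<close>, and \<open>b\<close> to \<open>c\<close>; adding \<open>b\<close> makes
        \<open>U\<close> invariant again.\<close>
      let ?U = "if c \<in> U then insert b U else U"
      have "?U \<subseteq> insert b A - T" using U assms by auto
      moreover have "(transpose b c \<circ> \<sigma>) ` ?U \<subseteq> ?U"
        using U \<sigma>b assms(1) by (auto simp: transpose_def)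
      ultimately have "?U = {}" using L unfolding hits_cycles_def by blast
      then show ?thesis by (auto split: if_splits)
    qed
    ultimately show ?R by (auto simp: hits_cycles_def)
  }
  {
    assume R: ?R
    have "U = {}" if U: "U \<subseteq> insert b A - T" "(transpose b c \<circ> \<sigma>) ` U \<subseteq> U" for U
    proof -
      have cU: "c \<in> U" if "b \<in> U"
        using U(2) that \<sigma>b by force
      have "\<sigma> i \<in> U - {b}" if "i \<in> U - {b}" for i
      proof -
        have "i \<in> A" using that U by auto
        then have "\<sigma> i \<noteq> b" using \<sigma>A assms by metis
        moreover have "transpose b c (\<sigma> i) \<in> U" using that U by auto
        ultimately show ?thesis using cU by (auto simp: transpose_def split: if_splits)
      qed
      then have "\<sigma> ` (U - {b}) \<subseteq> U - {b}" by blast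
      moreover have "U - {b} \<subseteq> A - T" using U by blast
      ultimately have "U - {b} = {}"
        using R unfolding hits_cycles_def by blast
      then show ?thesis using cU R by auto
    qed
    then show ?L by (auto simp: hits_cycles_def)
  }
qed

section \<open>Counting permutations and sections\<close>

text \<open>A new point can be inserted in as many ways as its enlarged fibre has points, which
  raises one factorial by one step.\<close>

lemma card_fibre_perms:
  assumes "finite A"
  shows "card (fibre_perms x A) = (\<Prod>v\<in>x ` A. fact (card (fibre x A v)))"
  using assms
proof (induction A rule: finite_induct)
  case empty
  then show ?case by (simp add: fibre_perms_def)
next
  case (insert b A)
  let ?v = "x b" and ?P = "\<lambda>A. \<Prod>v\<in>x ` A - {x b}. fact (card (fibre x A v)) :: nat"
  have not_in: "b \<notin> fibre x A v" for v
    using insert.hyps by (simp add: fibre_def)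
  \<comment> \<open>Only the fibre of \<open>b\<close> grows, so its factor is isolated; for a new
    value \<open>x b\<close> the fibre in \<open>A\<close> is empty and the factor is
    \<open>fact 0 = 1\<close>.\<close>
  have split: "(\<Prod>v\<in>x ` A. fact (card (fibre x A v))) = fact (card (fibre x A ?v)) * ?P A"
    using insert.hyps by (cases "?v \<in> x ` A") (auto simp: prod.remove fibre_eq_empty_iff[THEN iffD2])
  have "card (fibre_perms x (insert b A)) = card (fibre x (insert b A) ?v) * card (fibre_perms x A)"
    using bij_betw_same_card[OF fibre_perms_insert[OF insert.hyps(2), of x]]
    by (simp add: card_cartesian_product)
  also have "\<dots> = Suc (card (fibre x A ?v)) * (fact (card (fibre x A ?v)) * ?P A)"
    using insert not_in by (simp add: fibre_insert split)
  also have "\<dots> = fact (card (fibre x (insert b A) ?v)) * ?P A"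
    using insert.hyps not_in by (simp add: fibre_insert algebra_simps)
  also have "?P A = ?P (insert b A)"
    by (rule prod.cong) (auto simp: fibre_insert)
  also have "fact (card (fibre x (insert b A) ?v)) * ?P (insert b A) =
      (\<Prod>v\<in>x ` insert b A. fact (card (fibre x (insert b A) v)))"
    using insert.hyps by (subst prod.remove[of _ ?v]) auto
  finally show ?case .
qed

text \<open>Induction on the points outside \<open>T\<close>. Such a point must not become a fixed
  point, so it has one choice for each earlier point of its fibre, and (m - 1)! becomes m!.
  Initially \<open>T\<close> is permuted freely, with m! = m (m - 1)! in each fibre.\<close>

lemma card_fibre_perms_hits_cycles:
  assumes "finite A" "T \<subseteq> A"
  shows "card {\<tau> \<in> fibre_perms x A. hits_cycles A T \<tau>} =
    (\<Prod>v\<in>x ` A. card (fibre x T v) * fact (card (fibre x A v) - 1))"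
proof -
  have "finite (A - T)" "finite T" using assms by (auto intro: finite_subset)
  have "card {\<tau> \<in> fibre_perms x (T \<union> B). hits_cycles (T \<union> B) T \<tau>} =
    (\<Prod>v\<in>x ` (T \<union> B). card (fibre x T v) * fact (card (fibre x (T \<union> B) v) - 1))"
    if "finite B" "B \<inter> T = {}" for B
    using that
  proof (induction B rule: finite_induct)
    case empty
    have "{\<tau> \<in> fibre_perms x T. hits_cycles T T \<tau>} = fibre_perms x T"
      by (auto simp: hits_cycles_def)
    moreover have "card (fibre x T v) * fact (card (fibre x T v) - 1) = (fact (card (fibre x T v)) :: nat)"
      if "v \<in> x ` T" for v
      using that \<open>finite T\<close> fibre_eq_empty_iff[of x T v] by (simp add: fact_reduce card_gt_0_iff)
    ultimately show ?case
      using \<open>finite T\<close> by (simp add: card_fibre_perms)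
  next
    case (insert b B)
    let ?A = "T \<union> B" and ?v = "x b"
    let ?P = "\<lambda>A. \<Prod>v\<in>x ` A - {?v}. card (fibre x T v) * fact (card (fibre x A v) - 1) :: nat"
    have b: "b \<notin> ?A" "b \<notin> T" and fin: "finite ?A"
      using insert \<open>finite T\<close> by auto
    have ins: "T \<union> insert b B = insert b ?A" by auto
    have IH: "card {\<tau> \<in> fibre_perms x ?A. hits_cycles ?A T \<tau>} =
        (\<Prod>v\<in>x ` ?A. card (fibre x T v) * fact (card (fibre x ?A v) - 1))"
      using insert by auto
    let ?g = "\<lambda>(c, \<sigma>). transpose b c \<circ> \<sigma>"
    let ?S = "fibre x (insert b ?A) ?v \<times> fibre_perms x ?A"
    have bij: "bij_betw ?g ?S (fibre_perms x (insert b ?A))"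
      by (rule fibre_perms_insert[OF b(1)])
    have hit: "hits_cycles (insert b ?A) T (?g a) \<longleftrightarrow> fst a \<noteq> b \<and> hits_cycles ?A T (snd a)"
      if "a \<in> ?S" for a
      using that hits_cycles_insert[OF b, of "snd a" "fst a"]
      by (auto simp: fibre_def fibre_perms_def)
    have "{\<tau> \<in> fibre_perms x (insert b ?A). hits_cycles (insert b ?A) T \<tau>} =
        ?g ` {a \<in> ?S. hits_cycles (insert b ?A) T (?g a)}"
      unfolding bij_betw_imp_surj_on[OF bij, symmetric] by blast
    also have "{a \<in> ?S. hits_cycles (insert b ?A) T (?g a)} =
        {a \<in> ?S. fst a \<noteq> b \<and> hits_cycles ?A T (snd a)}"
      using hit by blast
    also have "\<dots> = fibre x ?A ?v \<times> {\<tau> \<in> fibre_perms x ?A. hits_cycles ?A T \<tau>}"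
      using b by (auto simp: fibre_def)
    also have "card (?g ` \<dots>) = card \<dots>"
      by (rule card_image, rule inj_on_subset[OF bij_betw_imp_inj_on[OF bij]]) (auto simp: fibre_insert)
    finally have "card {\<tau> \<in> fibre_perms x (insert b ?A). hits_cycles (insert b ?A) T \<tau>} =
        card (fibre x ?A ?v) * (\<Prod>v\<in>x ` ?A. card (fibre x T v) * fact (card (fibre x ?A v) - 1))"
      by (simp add: card_cartesian_product IH)
    also have "\<dots> = card (fibre x T ?v) * fact (card (fibre x ?A ?v)) * ?P ?A"
    proof (cases "?v \<in> x ` ?A")
      case True
      then have "card (fibre x ?A ?v) > 0"
        using fin fibre_eq_empty_iff[of x ?A ?v] by (simp add: card_gt_0_iff)
      then have "fact (card (fibre x ?A ?v)) = card (fibre x ?A ?v) * (fact (card (fibre x ?A ?v) - 1) :: nat)"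
        by (simp add: fact_reduce)
      then show ?thesis
        using True fin by (subst prod.remove[of _ ?v]) auto
    next
      \<comment> \<open>A fibre without earlier points contains no point of \<open>T\<close> either,
        so both sides vanish.\<close>
      case False
      then have "fibre x ?A ?v = {}" "fibre x T ?v = {}"
        unfolding fibre_eq_empty_iff by auto
      then show ?thesis by simp
    qed
    also have "fact (card (fibre x ?A ?v)) = (fact (card (fibre x (insert b ?A) ?v) - 1) :: nat)"
      using b fin by (simp add: fibre_insert) (simp add: fibre_def)
    also have "?P ?A = ?P (insert b ?A)"
      by (rule prod.cong) (auto simp: fibre_insert)
    also have "card (fibre x T ?v) * fact (card (fibre x (insert b ?A) ?v) - 1) * ?P (insert b ?A) =
       (\<Prod>v\<in>x ` insert b ?A. card (fibre x T v) * fact (card (fibre x (insert b ?A) v) - 1))"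
      using fin by (subst prod.remove[of "x ` insert b ?A" ?v]) auto
    finally show ?case unfolding ins .
  qed
  from this[of "A - T"] show ?thesis
    using assms \<open>finite (A - T)\<close> by (auto simp: Un_absorb1)
qed

text \<open>The product of the \<^term>\<open>card (fibre x T v)\<close> counts the sections of \<open>x\<close> with values in \<open>T\<close>.\<close>

lemma sum_subsets_prod_card_fibre:
  fixes t :: "'b::comm_ring_1"
  assumes "finite A"
  shows "(\<Sum>T\<in>Pow A. t ^ card T * (1 - t) ^ card (A - T) * of_nat (\<Prod>v\<in>x ` A. card (fibre x T v))) =
    t ^ card (x ` A) * of_nat (\<Prod>v\<in>x ` A. card (fibre x A v))"
proof -
  let ?w = "\<lambda>T. t ^ card T * (1 - t) ^ card (A - T)"
  let ?S = "\<lambda>T. Pi\<^sub>E (x ` A) (fibre x T)"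
  have card_S: "card (?S T) = (\<Prod>v\<in>x ` A. card (fibre x T v))" for T
    using assms by (simp add: card_PiE)
  have fin: "finite (?S A)"
    using assms by (intro finite_PiE) auto
  have section_iff: "s \<in> ?S T \<longleftrightarrow> s ` x ` A \<subseteq> T" if "T \<subseteq> A" "s \<in> ?S A" for s T
    using that unfolding PiE_iff fibre_def mem_Collect_eq image_subset_iff by blast
  have "(\<Sum>T\<in>Pow A. ?w T * of_nat (\<Prod>v\<in>x ` A. card (fibre x T v))) =
      (\<Sum>T\<in>Pow A. \<Sum>s\<in>?S A. if s ` x ` A \<subseteq> T then ?w T else 0)"
  proof (rule sum.cong[OF refl])
    fix T assume T: "T \<in> Pow A"
    have "?S T \<subseteq> ?S A" using T by (intro PiE_mono) (auto simp: fibre_def)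
    then have "?S T = {s \<in> ?S A. s \<in> ?S T}"
      by auto
    also have "\<dots> = {s \<in> ?S A. s ` x ` A \<subseteq> T}"
      using T by (intro Collect_cong conj_cong refl section_iff) auto
    finally have "?S T = {s \<in> ?S A. s ` x ` A \<subseteq> T}" .
    then have "(\<Prod>v\<in>x ` A. card (fibre x T v)) = card {s \<in> ?S A. s ` x ` A \<subseteq> T}"
      by (simp only: card_S[of T, symmetric])
    then show "?w T * of_nat (\<Prod>v\<in>x ` A. card (fibre x T v)) =
        (\<Sum>s\<in>?S A. if s ` x ` A \<subseteq> T then ?w T else 0)"
      using fin by (simp add: mult.commute flip: sum.inter_filter)
  qed
  also have "\<dots> = (\<Sum>s\<in>?S A. \<Sum>T\<in>Pow A. if s ` x ` A \<subseteq> T then ?w T else 0)"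
    by (rule sum.swap)
  \<comment> \<open>For a fixed section \<open>s\<close> the admissible \<open>T\<close> are the
    supersets of its image, which has one point for each value of \<open>x\<close>, since
    \<open>x\<close> is a left inverse of \<open>s\<close>.\<close>
  also have "\<dots> = (\<Sum>s\<in>?S A. t ^ card (x ` A))"
  proof (rule sum.cong[OF refl])
    fix s assume s: "s \<in> ?S A"
    have "s ` x ` A \<subseteq> A" using section_iff[of A s] s by simp
    have "inj_on s (x ` A)"
      using s by (intro inj_on_inverseI[of _ x]) (auto simp: PiE_iff fibre_def)
    have "(\<Sum>T\<in>Pow A. if s ` x ` A \<subseteq> T then ?w T else 0) = (\<Sum>T | T \<subseteq> A \<and> s ` x ` A \<subseteq> T. ?w T)"
      using assms by (simp flip: sum.inter_filter)
    also have "\<dots> = t ^ card (s ` x ` A)"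
      by (rule sum_supersets_power_card) fact+
    also have "card (s ` x ` A) = card (x ` A)"
      by (rule card_image) fact
    finally show "(\<Sum>T\<in>Pow A. if s ` x ` A \<subseteq> T then ?w T else 0) = t ^ card (x ` A)" .
  qed
  also have "\<dots> = t ^ card (x ` A) * of_nat (\<Prod>v\<in>x ` A. card (fibre x A v))"
    by (simp add: card_S mult.commute)
  finally show ?thesis .
qed

section \<open>Cycle products and their sum\<close>

text \<open>The orbits of a permutation of \<open>A\<close> partition \<open>A\<close>, so the
  identity for disjoint blocks applies.\<close>

lemma prod_cycles_eq_sum_hits_cycles:
  fixes t :: "'b::comm_ring_1"
  assumes "finite A" "\<tau> permutes A"
  shows "(\<Prod>C\<in>orbit \<tau> ` A. 1 - (1 - t) ^ card C) =
    (\<Sum>T | T \<subseteq> A \<and> hits_cycles A T \<tau>. t ^ card T * (1 - t) ^ card (A - T))"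
proof -
  have perm: "permutation \<tau>" using assms by (auto simp: permutation_permutes)
  have sub: "orbit \<tau> i \<subseteq> A" if "i \<in> A" for i
    using that permutes_image[OF assms(2)] by (intro orbit_subset_invariant) auto
  have "\<Union>(orbit \<tau> ` A) = A"
    using sub permutation_self_in_orbit[OF perm] by blast
  moreover have "pairwise disjnt (orbit \<tau> ` A)"
  proof (rule pairwiseI, clarsimp)
    fix i j assume "orbit \<tau> i \<noteq> orbit \<tau> j"
    then show "disjnt (orbit \<tau> i) (orbit \<tau> j)"
      unfolding disjnt_iff
      by (metis orbit_swap orbit_trans permutation_self_in_orbit[OF perm] subsetI subset_antisym)
  qed
  moreover have "finite C" if "C \<in> orbit \<tau> ` A" for C
    using that finite_orbit[OF permutation_self_in_orbit[OF perm]] by auto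
  ultimately show ?thesis
    using prod_blocks_eq_sum_hitting_sets[of "orbit \<tau> ` A" t] assms
    by (simp add: hits_cycles_iff_orbits)
qed

text \<open>Exchanging the sums lets the permutations be counted for each fixed \<open>T\<close>;
  the count is then averaged over \<open>T\<close>. The ring is general so that \<open>t\<close> can
  be a polynomial variable.\<close>

theorem sum_fibre_perms_prod_cycles:
  fixes t :: "'b::comm_ring_1"
  assumes "finite A"
  shows "(\<Sum>\<tau>\<in>fibre_perms x A. \<Prod>C\<in>orbit \<tau> ` A. 1 - (1 - t) ^ card C) =
    t ^ card (x ` A) * of_nat (\<Prod>v\<in>x ` A. fact (card (fibre x A v)))"
proof -
  let ?w = "\<lambda>T. t ^ card T * (1 - t) ^ card (A - T)"
  let ?F = "\<Prod>v\<in>x ` A. fact (card (fibre x A v) - 1) :: nat"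
  have "(\<Sum>\<tau>\<in>fibre_perms x A. \<Prod>C\<in>orbit \<tau> ` A. 1 - (1 - t) ^ card C) =
      (\<Sum>\<tau>\<in>fibre_perms x A. \<Sum>T\<in>Pow A. if hits_cycles A T \<tau> then ?w T else 0)"
    using assms by (intro sum.cong refl)
      (auto simp: fibre_perms_def prod_cycles_eq_sum_hits_cycles simp flip: sum.inter_filter)
  also have "\<dots> = (\<Sum>T\<in>Pow A. \<Sum>\<tau>\<in>fibre_perms x A. if hits_cycles A T \<tau> then ?w T else 0)"
    by (rule sum.swap)
  also have "\<dots> = (\<Sum>T\<in>Pow A. ?w T * of_nat (\<Prod>v\<in>x ` A. card (fibre x T v)) * of_nat ?F)"
  proof (rule sum.cong[OF refl])
    fix T assume "T \<in> Pow A"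
    then have "of_nat (card {\<tau> \<in> fibre_perms x A. hits_cycles A T \<tau>}) =
        (of_nat (\<Prod>v\<in>x ` A. card (fibre x T v)) * of_nat ?F :: 'b)"
      using assms by (simp only: card_fibre_perms_hits_cycles Pow_iff prod.distrib of_nat_mult)
    moreover have "(\<Sum>\<tau>\<in>fibre_perms x A. if hits_cycles A T \<tau> then ?w T else 0) =
        ?w T * of_nat (card {\<tau> \<in> fibre_perms x A. hits_cycles A T \<tau>})"
      using assms by (simp add: mult.commute flip: sum.inter_filter)
    ultimately show "(\<Sum>\<tau>\<in>fibre_perms x A. if hits_cycles A T \<tau> then ?w T else 0) =
        ?w T * of_nat (\<Prod>v\<in>x ` A. card (fibre x T v)) * of_nat ?F"
      by (simp only: mult.assoc)
  qed
  also have "\<dots> = t ^ card (x ` A) * of_nat (\<Prod>v\<in>x ` A. card (fibre x A v)) * of_nat ?F"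
    by (simp only: sum_subsets_prod_card_fibre[OF assms] flip: sum_distrib_right)
  also have "\<dots> = t ^ card (x ` A) * of_nat (\<Prod>v\<in>x ` A. card (fibre x A v) * fact (card (fibre x A v) - 1))"
    by (simp only: prod.distrib of_nat_mult mult.assoc)
  also have "(\<Prod>v\<in>x ` A. card (fibre x A v) * fact (card (fibre x A v) - 1)) =
      (\<Prod>v\<in>x ` A. fact (card (fibre x A v)) :: nat)"
  proof (rule prod.cong[OF refl])
    fix v assume "v \<in> x ` A"
    then have "card (fibre x A v) > 0"
      using assms fibre_eq_empty_iff[of x A v] by (simp add: card_gt_0_iff)
    then show "card (fibre x A v) * fact (card (fibre x A v) - 1) = (fact (card (fibre x A v)) :: nat)"
      by (simp add: fact_reduce)
  qed
  finally show ?thesis .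
qed

section \<open>Tuples\<close>

text \<open>Constancy along a cycle follows from invariance under one step of \<open>\<tau>\<close>.
  The condition thus becomes membership of \<open>\<tau>\<close> in the stabilizer of the
  tuple.\<close>

lemma constant_on_cycles_iff:
  assumes "\<tau> \<in> Sym k"
  shows "xs \<in> constant_on_cycles k X \<tau> \<longleftrightarrow> xs \<in> X \<and> \<tau> \<in> fibre_perms ((!) xs) {..<k}"
proof -
  have \<tau>: "\<tau> permutes {..<k}" using assms by (simp add: Sym_def)
  then have perm: "permutation \<tau>" by (auto simp: permutation_permutes)
  have "(\<forall>C\<in>perm_cycles k \<tau>. \<forall>i\<in>C. \<forall>j\<in>C. xs ! i = xs ! j) \<longleftrightarrow> (\<forall>i<k. xs ! \<tau> i = xs ! i)"
    (is "?L \<longleftrightarrow> ?R")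
  proof
    assume ?L
    then show ?R
      using permutation_self_in_orbit[OF perm] orbit.base[of \<tau>] unfolding perm_cycles_def by blast
  next
    assume R: ?R
    have "xs ! j = xs ! i" if "i < k" "j \<in> orbit \<tau> i" for i j
    proof -
      have "orbit \<tau> i \<subseteq> {j. j < k \<and> xs ! j = xs ! i}"
      proof (rule orbit_subset_invariant)
        show "\<tau> ` {j. j < k \<and> xs ! j = xs ! i} \<subseteq> {j. j < k \<and> xs ! j = xs ! i}"
          using R permutes_in_image[OF \<tau>] by fastforce
      qed (use that in simp)
      then show ?thesis using that by auto
    qed
    then show ?L unfolding perm_cycles_def by fastforce
  qed
  then show ?thesis
    using \<tau> by (auto simp: constant_on_cycles_def fibre_perms_def)
qed

text \<open>With \<open>t\<close> the polynomial variable, the sum of the cycle products is a single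
  monomial whose degree is the number of distinct entries; its coefficient is the order of the
  stabilizer.\<close>

lemma sum_stabilizer_cycle_weight:
  assumes "length xs = k"
  shows "(\<Sum>\<tau>\<in>fibre_perms ((!) xs) {..<k}. cycle_weight k d \<tau>) =
    (if card (set xs) = d then \<Prod>v\<in>set xs. fact (count (mset xs) v) else 0)"
proof -
  have im: "(!) xs ` {..<k} = set xs"
    using assms by (auto simp: set_conv_nth)
  have fib: "card (fibre ((!) xs) {..<k} v) = count (mset xs) v" for v
    using assms unfolding fibre_def count_mset count_list_eq_length_filter length_filter_conv_card
    by (intro arg_cong[of _ _ card]) auto
  let ?N = "\<Prod>v\<in>set xs. fact (count (mset xs) v) :: nat"
  have "(\<Sum>\<tau>\<in>fibre_perms ((!) xs) {..<k}. cycle_weight k d \<tau>) =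
      coeff (\<Sum>\<tau>\<in>fibre_perms ((!) xs) {..<k}. \<Prod>C\<in>orbit \<tau> ` {..<k}. 1 - (1 - [:0, 1:]) ^ card C) d"
    by (simp add: cycle_weight_def perm_cycles_def coeff_sum)
  also have "\<dots> = coeff ([:0, 1:] ^ card (set xs) * of_nat ?N :: int poly) d"
    by (simp only: sum_fibre_perms_prod_cycles[OF finite_lessThan] im fib)
  also have "[:0, 1:] ^ card (set xs) * of_nat ?N = (monom (of_nat ?N) (card (set xs)) :: int poly)"
    by (simp add: monom_altdef of_nat_poly mult.commute del: of_nat_prod)
  finally show ?thesis by simp
qed

theorem theorem1p10:
  fixes D :: "'a set" and X :: "'a list set" and f :: "'a list \<Rightarrow> complex" and k d :: nat
  assumes "k > 0"
    and "X \<subseteq> tuples D k"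
    and "finite X"
    and "symmetric_set k X"
    and "d > 0"
    and "symmetric_fun k X f"
  shows "(\<Sum>M \<in> msets_distinct d X. mset_value X f M) =
    1 / fact k * (\<Sum>\<tau> \<in> Sym k. of_int (cycle_weight k d \<tau>) *
      (\<Sum>xs \<in> constant_on_cycles k X \<tau>. f xs))"
proof -
  let ?G = "\<lambda>xs. fibre_perms ((!) xs) {..<k}"
  let ?Y = "{xs \<in> X. card (set xs) = d}"
  let ?N = "\<lambda>M. \<Prod>v\<in>set_mset M. fact (count M v) :: nat"
  have len: "length xs = k" if "xs \<in> X" for xs
    using that assms(2) by (auto simp: tuples_def)
  have finS: "finite (Sym k)"
    by (simp add: Sym_def finite_permutations)
  \<comment> \<open>Writing the condition that links \<open>\<tau>\<close> and the tuple as an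
    indicator allows the sums to be exchanged.\<close>
  have "(\<Sum>\<tau>\<in>Sym k. of_int (cycle_weight k d \<tau>) * (\<Sum>xs\<in>constant_on_cycles k X \<tau>. f xs)) =
      (\<Sum>\<tau>\<in>Sym k. \<Sum>xs\<in>X. if \<tau> \<in> ?G xs then of_int (cycle_weight k d \<tau>) * f xs else 0)"
  proof (rule sum.cong[OF refl])
    fix \<tau> assume "\<tau> \<in> Sym k"
    then have "constant_on_cycles k X \<tau> = {xs \<in> X. \<tau> \<in> ?G xs}"
      by (auto simp: constant_on_cycles_iff)
    then show "of_int (cycle_weight k d \<tau>) * (\<Sum>xs\<in>constant_on_cycles k X \<tau>. f xs) =
        (\<Sum>xs\<in>X. if \<tau> \<in> ?G xs then of_int (cycle_weight k d \<tau>) * f xs else 0)"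
      using assms(3) by (simp add: sum_distrib_left flip: sum.inter_filter)
  qed
  also have "\<dots> = (\<Sum>xs\<in>X. \<Sum>\<tau>\<in>Sym k. if \<tau> \<in> ?G xs then of_int (cycle_weight k d \<tau>) * f xs else 0)"
    by (rule sum.swap)
  also have "\<dots> = (\<Sum>xs\<in>X. if card (set xs) = d then of_nat (?N (mset xs)) * f xs else 0)"
  proof (rule sum.cong[OF refl])
    fix xs assume xs: "xs \<in> X"
    have "{\<tau> \<in> Sym k. \<tau> \<in> ?G xs} = ?G xs"
      by (auto simp: Sym_def fibre_perms_def)
    then have "(\<Sum>\<tau>\<in>Sym k. if \<tau> \<in> ?G xs then of_int (cycle_weight k d \<tau>) * f xs else 0) =
        of_int (\<Sum>\<tau>\<in>?G xs. cycle_weight k d \<tau>) * f xs"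
      using finS by (simp add: sum_distrib_right flip: sum.inter_filter)
    then show "(\<Sum>\<tau>\<in>Sym k. if \<tau> \<in> ?G xs then of_int (cycle_weight k d \<tau>) * f xs else 0) =
        (if card (set xs) = d then of_nat (?N (mset xs)) * f xs else 0)"
      by (simp add: sum_stabilizer_cycle_weight[OF len[OF xs]])
  qed
  also have "\<dots> = (\<Sum>xs\<in>?Y. of_nat (?N (mset xs)) * f xs)"
    using assms(3) by (simp flip: sum.inter_filter)
  also have "\<dots> = (\<Sum>M\<in>mset ` ?Y. \<Sum>xs | xs \<in> ?Y \<and> mset xs = M. of_nat (?N (mset xs)) * f xs)"
    using assms(3) by (intro sum.image_gen) simp
  also have "\<dots> = (\<Sum>M\<in>mset ` ?Y. fact k * mset_value X f M)"
  proof (rule sum.cong[OF refl])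
    fix M assume "M \<in> mset ` ?Y"
    then obtain ys where ys: "ys \<in> X" "card (set ys) = d" and M: "M = mset ys" by auto
    \<comment> \<open>Symmetry of \<open>X\<close> puts every ordering of \<open>M\<close> into
      \<open>X\<close>.\<close>
    have "{xs. xs \<in> ?Y \<and> mset xs = M} = permutations_of_multiset M"
    proof (intro equalityI subsetI)
      fix xs assume "xs \<in> permutations_of_multiset M"
      then have xs: "mset xs = mset ys" by (simp add: permutations_of_multiset_def M)
      then obtain \<tau> where "\<tau> permutes {..<length ys}" "permute_list \<tau> ys = xs"
        by (rule mset_eq_permutation)
      then have "xs \<in> X"
        using assms(4) ys(1) len by (auto simp: symmetric_set_def Sym_def)
      then show "xs \<in> {xs. xs \<in> ?Y \<and> mset xs = M}"
        using ys xs mset_eq_setD[OF xs] by (simp add: M)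
    qed (auto simp: permutations_of_multiset_def)
    moreover have "f xs = mset_value X f M" if "xs \<in> X" "mset xs = M" for xs
      using mset_value_mset[OF assms(2,6) that(1)] that by simp
    ultimately have "(\<Sum>xs | xs \<in> ?Y \<and> mset xs = M. of_nat (?N (mset xs)) * f xs) =
        (\<Sum>xs\<in>permutations_of_multiset M. of_nat (?N M) * mset_value X f M)"
      by (intro sum.cong) (auto simp: permutations_of_multiset_def)
    also have "\<dots> = of_nat (card (permutations_of_multiset M) * ?N M) * mset_value X f M"
      by simp
    \<comment> \<open>The number of orderings is a multinomial coefficient, whose denominator is the
      order of the stabilizer.\<close>
    also have "card (permutations_of_multiset M) * ?N M = fact k"
      using card_permutations_of_multiset_aux[of M] len[OF ys(1)] by (simp add: M)
    finally show "(\<Sum>xs | xs \<in> ?Y \<and> mset xs = M. of_nat (?N (mset xs)) * f xs) =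
        fact k * mset_value X f M"
      by simp
  qed
  also have "mset ` ?Y = msets_distinct d X"
    by (auto simp: msets_distinct_def msets_def)
  finally show ?thesis
    by (simp flip: sum_distrib_left)
qed

end
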